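(* Let $k\geq1$ be an integer and let $f:[0,1]^k\to\mathbb{R}$ be a (measurable) function such that for some $x\in[0,1]^k$, $f$ is locally $\alpha$-Hölder at $x$ for some $\alpha>0$. Let $\mu$ be the lift of Lebesgue measure onto the graph of $f$. Let $p\in[1,\infty]$ and $q\in[1,\infty)$ with $k(q-1)>\alpha$. Then the extension estimate $$\|\widehat{g\mu}\|_{L^q(\mathbb{R}^{k+1})}\lesssim\|g\|_{L^p(\mu)}\quad\text{for all } g\in L^p(\mu)$$ cannot hold whenever $$p<\frac{kq}{k(q-1)-\alpha}.$$
   Context: The function $f$ is locally $\alpha$-Hölder at $x$ if there exist $\delta\in(0,1)$ and $C>0$ such that $|f(x)-f(t)|\leq C|x-t|^{\alpha}$ for all $t\in[0,1]^k$ with $|x-t|<\delta$. The lift of Lebesgue measure onto the graph of $f$ is the Borel measure on $\mathbb{R}^{k+1}$ given by $\mu(E)=\mathcal{L}^k\{t\in[0,1]^k:(t,f(t))\in E\}$ for Borel $E\subset\mathbb{R}^{k+1}$, where $\mathcal{L}^k$ is $k$-dimensional Lebesgue measure. Here $\widehat{g\mu}(\xi)=\int e^{-2\pi i\xi\cdot y}g(y)\,d\mu(y)$, and $A\lesssim B$ means there is a finite constant $c$, independent of $g$, with $A\leq cB$. *)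

theory Defs
  imports "HOL-Analysis.Analysis" "HOL-Probability.Essential_Supremum"
begin

text \<open>
  The dimension k is \<open>CARD('k)\<close> and the space of dimension k+1 is the Euclidean space
  \<open>(real ^ 'k) \<times> real\<close>, whose library inner product, norm and \<open>lborel\<close> are the usual ones.
  A function on the unit cube is a total function of which only the values on the cube are used.
\<close>

definition unit_cube :: "(real ^ 'k) set" where
  "unit_cube = {t. \<forall>i. 0 \<le> t $ i \<and> t $ i \<le> 1}"

definition locally_holder_at :: "(real ^ 'k \<Rightarrow> real) \<Rightarrow> real \<Rightarrow> real ^ 'k \<Rightarrow> bool" where
  "locally_holder_at f \<alpha> x \<longleftrightarrow>
     (\<exists>\<delta> C. 0 < \<delta> \<and> \<delta> < 1 \<and> 0 < C \<and>
        (\<forall>t \<in> unit_cube. norm (x - t) < \<delta> \<longrightarrow> \<bar>f x - f t\<bar> \<le> C * norm (x - t) powr \<alpha>))"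

text \<open>
  The base measure is the completed Lebesgue measure on the cube, so that f need only be
  Lebesgue measurable.
\<close>

definition graph_measure :: "(real ^ 'k \<Rightarrow> real) \<Rightarrow> ((real ^ 'k) \<times> real) measure" where
  "graph_measure f = distr (lebesgue_on unit_cube) borel (\<lambda>t. (t, f t))"

definition fourier_meas ::
    "'a::euclidean_space measure \<Rightarrow> ('a \<Rightarrow> complex) \<Rightarrow> 'a \<Rightarrow> complex" where
  "fourier_meas M g \<xi> =
     (\<integral>y. exp (- (2 * complex_of_real pi * \<i> * complex_of_real (\<xi> \<bullet> y))) * g y \<partial>M)"

text \<open>
  The \<open>Lp\<close> norm for \<open>p \<in> [1, \<infinity>]\<close>, with value \<open>\<infinity>\<close> when g is not p-integrable.
  The inner case distinction is needed because \<open>powr\<close> is not available on \<open>ennreal\<close>.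
\<close>

definition Lp_norm :: "ennreal \<Rightarrow> 'a measure \<Rightarrow> ('a \<Rightarrow> complex) \<Rightarrow> ennreal" where
  "Lp_norm p M g =
     (if p = \<infinity> then esssup M (\<lambda>x. ennreal (norm (g x)))
      else let I = (\<integral>\<^sup>+ x. ennreal (norm (g x) powr enn2real p) \<partial>M)
           in if I = \<infinity> then \<infinity> else ennreal (enn2real I powr (1 / enn2real p)))"

definition Lp_space :: "ennreal \<Rightarrow> 'a measure \<Rightarrow> ('a \<Rightarrow> complex) set" where
  "Lp_space p M = {g \<in> borel_measurable M. Lp_norm p M g < \<infinity>}"

definition extension_estimate ::
    "'a::euclidean_space measure \<Rightarrow> ennreal \<Rightarrow> ennreal \<Rightarrow> bool" where
  "extension_estimate M p q \<longleftrightarrow>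
     (\<exists>c::real. 0 \<le> c \<and>
        (\<forall>g \<in> Lp_space p M. Lp_norm q lborel (fourier_meas M g) \<le> ennreal c * Lp_norm p M g))"

end

theory Submission
  imports Defs "HOL-Real_Asymp.Real_Asymp"
begin

text \<open>
  A Knapp-type example. Let \<open>r\<close> be small and let \<open>A\<close> be the part of \<open>\<real>\<^sup>k \<times> \<real>\<close> where \<open>\<bar>t - x\<bar> < r\<close> and
  \<open>\<bar>s - f x\<bar> \<le> C r\<^sup>\<alpha>\<close>. By the Hoelder condition \<open>A\<close> contains the graph of \<open>f\<close> over the cube points
  near \<open>x\<close>, so its mass \<open>m\<close> is at least a constant times \<open>r\<^sup>k\<close>. On a dual box of volume comparable
  to \<open>r\<^sup>-\<^sup>k\<^sup>-\<^sup>\<alpha>\<close> the phase is almost constant on \<open>A\<close>, so the transform of \<open>1\<^sub>A \<mu>\<close> has modulus at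
  least \<open>m / 2\<close> there. The extension estimate for \<open>1\<^sub>A\<close> then bounds
  \<open>m\<^sup>1\<^sup>-\<^sup>1\<^sup>/\<^sup>p r\<^sup>-\<^sup>(\<^sup>k\<^sup>+\<^sup>\<alpha>\<^sup>)\<^sup>/\<^sup>q\<close>, hence \<open>r\<close> to the power \<open>k (1 - 1/p) - (k + \<alpha>) / q\<close>, which is
  negative for the given range of \<open>p\<close>.
\<close>

section \<open>Fourier transforms of indicators and their \<open>L^q\<close> norms\<close>

text \<open>A phase of size at most 1/6 turns the exponential by an angle of at most
  \<open>pi / 3\<close>, where the cosine is at least 1/2. The contributions of points of
  \<open>A\<close> then cannot cancel.\<close>

lemma norm_fourier_indicator_ge:
  fixes M :: "'a::euclidean_space measure"
  assumes "finite_measure M" "A \<in> sets M" "sets M = sets borel"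
    and phase: "\<And>y. y \<in> A \<Longrightarrow> \<bar>\<xi> \<bullet> (y - y0)\<bar> \<le> 1 / 6"
  shows "measure M A / 2 \<le> norm (fourier_meas M (indicator A) \<xi>)"
proof -
  interpret finite_measure M by fact
  define e where "e y = exp (- (2 * complex_of_real pi * \<i> * complex_of_real (\<xi> \<bullet> y)))" for y
  \<comment> \<open>\<open>e\<close> is a character, so measuring phases from \<open>y0\<close>
    multiplies the transform by a unimodular constant and keeps its modulus.\<close>
  have e_diff: "e (y - y0) = e (- y0) * e y" for y
    by (simp add: e_def exp_add[symmetric] inner_diff_right algebra_simps)
  have norm_e: "norm (e y) = 1" for y
    by (simp add: e_def norm_exp)
  have Re_e: "Re (e y) = cos (2 * pi * (\<xi> \<bullet> y))" for y
    by (simp add: e_def Re_exp)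
  have meas: "(\<lambda>y. e (y - y0) * indicator A y) \<in> borel_measurable M"
  proof -
    have [measurable]: "A \<in> sets borel" using assms by simp
    have "(\<lambda>y. e (y - y0) * indicator A y) \<in> borel_measurable borel"
      unfolding e_def by measurable
    then show ?thesis
      using measurable_cong_sets[OF assms(3) refl] by blast
  qed
  have int: "integrable M (\<lambda>y. e (y - y0) * indicator A y)"
    by (rule integrable_const_bound[where B = 1])
       (use meas in \<open>auto simp: norm_mult norm_e indicator_def\<close>)
  have "measure M A / 2 = (\<integral>y. indicator A y / 2 \<partial>M)"
    using assms(2) by simp
  also have "\<dots> \<le> (\<integral>y. Re (e (y - y0) * indicator A y) \<partial>M)"
  proof (rule integral_mono)
    show "integrable M (\<lambda>y. indicator A y / 2 :: real)"
      using assms(2) by (simp add: emeasure_eq_measure)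
    show "integrable M (\<lambda>y. Re (e (y - y0) * indicator A y))"
      using int by (rule integrable_Re)
    fix y
    have "1 / 2 \<le> Re (e (y - y0))" if "y \<in> A"
    proof -
      have "2 * pi * \<bar>\<xi> \<bullet> (y - y0)\<bar> \<le> pi / 3"
        using mult_left_mono[OF phase[OF that], of "2 * pi"] by simp
      then have "cos (pi / 3) \<le> cos (2 * pi * \<bar>\<xi> \<bullet> (y - y0)\<bar>)"
        by (intro cos_monotone_0_pi_le) auto
      also have "cos (2 * pi * \<bar>\<xi> \<bullet> (y - y0)\<bar>) = cos (2 * pi * (\<xi> \<bullet> (y - y0)))"
        by (metis abs_mult abs_of_nonneg cos_abs_real mult_nonneg_nonneg pi_ge_zero zero_le_numeral)
      finally show ?thesis by (simp add: Re_e cos_60)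
    qed
    then show "indicator A y / 2 \<le> Re (e (y - y0) * indicator A y)"
      by (auto simp: indicator_def)
  qed
  also have "\<dots> = Re (\<integral>y. e (y - y0) * indicator A y \<partial>M)"
    using int by (rule integral_Re)
  also have "\<dots> \<le> norm (\<integral>y. e (y - y0) * indicator A y \<partial>M)"
    by (rule complex_Re_le_cmod)
  also have "(\<integral>y. e (y - y0) * indicator A y \<partial>M) = e (- y0) * fourier_meas M (indicator A) \<xi>"
    by (simp add: e_diff mult.assoc) (simp add: fourier_meas_def e_def)
  also have "norm \<dots> = norm (fourier_meas M (indicator A) \<xi>)"
    by (simp add: norm_mult norm_e)
  finally show ?thesis .
qed

text \<open>Chebyshev's inequality: the integral of \<open>norm (F x) powr q\<close> is at least its
  part over \<open>S\<close>, where the integrand is at least \<open>a powr q\<close>. It turns the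
  pointwise bound on the dual box into a bound on the norm of the transform.\<close>

lemma Lp_norm_ge:
  assumes "0 < q" "0 \<le> a" "S \<in> sets M" "emeasure M S < \<infinity>"
    and ge: "\<And>\<xi>. \<xi> \<in> S \<Longrightarrow> a \<le> norm (F \<xi>)"
  shows "ennreal (a * measure M S powr (1 / q)) \<le> Lp_norm (ennreal q) M F"
proof -
  define I where "I = (\<integral>\<^sup>+ x. ennreal (norm (F x) powr q) \<partial>M)"
  have "ennreal (a powr q * measure M S) = (\<integral>\<^sup>+ x. ennreal (a powr q) * indicator S x \<partial>M)"
    using assms by (simp add: nn_integral_cmult_indicator emeasure_eq_ennreal_measure ennreal_mult)
  also have "\<dots> \<le> I"
    unfolding I_def using assms
    by (intro nn_integral_mono) (auto simp: indicator_def intro!: ennreal_leI powr_mono2)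
  finally have I: "ennreal (a powr q * measure M S) \<le> I" .
  show ?thesis
  proof (cases "I = \<infinity>")
    \<comment> \<open>The norm is infinite by definition here.\<close>
    case True
    then show ?thesis using assms by (simp add: Lp_norm_def I_def Let_def)
  next
    case False
    then have "a powr q * measure M S \<le> enn2real I"
      using enn2real_mono[OF I] by (simp add: less_top)
    then have "(a powr q * measure M S) powr (1 / q) \<le> enn2real I powr (1 / q)"
      using assms by (intro powr_mono2) auto
    moreover have "(a powr q * measure M S) powr (1 / q) = a * measure M S powr (1 / q)"
      using assms by (simp add: powr_mult powr_powr)
    ultimately show ?thesis
      using False assms by (simp add: Lp_norm_def I_def Let_def ennreal_leI)
  qed
qed

lemma Lp_norm_indicator:
  assumes "0 < p" "A \<in> sets M" "emeasure M A < \<infinity>"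
  shows "Lp_norm (ennreal p) M (indicator A) = ennreal (measure M A powr (1 / p))"
proof -
  have "(\<integral>\<^sup>+ x. ennreal (norm (indicator A x :: complex) powr p) \<partial>M) = (\<integral>\<^sup>+ x. indicator A x \<partial>M)"
    using assms(1) by (intro nn_integral_cong) (auto simp: indicator_def)
  then have "(\<integral>\<^sup>+ x. ennreal (norm (indicator A x :: complex) powr p) \<partial>M) = emeasure M A"
    using assms(2) by simp
  then show ?thesis
    using assms by (simp add: Lp_norm_def Let_def measure_def)
qed

section \<open>The lifted measure near the graph point over \<open>x\<close>\<close>

lemma unit_cube_eq_cbox: "unit_cube = cbox 0 (1 :: real ^ 'k)"
  by (auto simp: unit_cube_def mem_box_cart)

lemma graph_map_measurable:
  fixes f :: "real ^ 'k \<Rightarrow> real"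
  assumes "f \<in> borel_measurable (lebesgue_on unit_cube)"
  shows "(\<lambda>t. (t, f t)) \<in> borel_measurable (lebesgue_on unit_cube)"
proof -
  have "(\<lambda>t::real^'k. t) \<in> borel_measurable (lebesgue_on unit_cube)"
    by (intro measurable_restrict_space1 measurable_completion) simp
  then show ?thesis using assms by (rule borel_measurable_Pair)
qed

lemma finite_measure_graph_measure:
  fixes f :: "real ^ 'k \<Rightarrow> real"
  assumes "f \<in> borel_measurable (lebesgue_on unit_cube)"
  shows "finite_measure (graph_measure f)"
proof -
  have "finite_measure (lebesgue_on (unit_cube :: (real ^ 'k) set))"
    by (rule finite_measureI)
       (simp add: unit_cube_eq_cbox emeasure_restrict_space emeasure_lborel_cbox_eq)
  then show ?thesis
    unfolding graph_measure_def
    by (rule finite_measure.finite_measure_distr) (rule graph_map_measurable[OF assms])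
qed

text \<open>Shrinking the cube towards \<open>x\<close> puts a copy of side \<open>s\<close> into the cube near \<open>x\<close>.\<close>

lemma unit_cube_ball_measure_ge:
  fixes x :: "real ^ 'k"
  assumes "x \<in> unit_cube" "0 \<le> s" "s \<le> 1" "\<And>t. t \<in> unit_cube \<Longrightarrow> s * norm (t - x) < r"
  shows "s ^ CARD('k) \<le> measure lebesgue (unit_cube \<inter> ball x r)"
proof -
  define T where "T = (\<lambda>t. s *\<^sub>R t + (1 - s) *\<^sub>R x) ` cbox 0 (1 :: real ^ 'k)"
  \<comment> \<open>\<open>T\<close> consists of convex combinations of cube points with
    \<open>x\<close>, so convexity keeps it in the cube, even when \<open>x\<close> lies on the
    boundary.\<close>
  have "convex (unit_cube :: (real ^ 'k) set)"
    by (simp add: unit_cube_eq_cbox)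
  then have cube: "T \<subseteq> unit_cube"
    using assms(1-3) unfolding T_def unit_cube_eq_cbox[symmetric]
    by (auto intro!: convexD)
  have "s *\<^sub>R t + (1 - s) *\<^sub>R x - x = s *\<^sub>R (t - x)" for t
    by (simp add: algebra_simps)
  then have "T \<subseteq> ball x r"
    using assms(2,4) unfolding T_def unit_cube_eq_cbox[symmetric]
    by (auto simp: dist_commute[of x]) (simp add: dist_norm)
  with cube have sub: "T \<subseteq> unit_cube \<inter> ball x r" by simp
  have "T \<in> sets lborel"
    by (simp add: T_def image_affinity_cbox)
  then have "measure lebesgue T = measure lborel T"
    by (rule measure_completion)
  also have "\<dots> = s ^ CARD('k) * measure lborel (cbox 0 (1 :: real ^ 'k))"
    using assms(2) unfolding T_def by (subst content_image_affinity_cbox) simp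
  \<comment> \<open>The point \<open>x\<close> witnesses that the box is nonempty, which the content
    formula asks for.\<close>
  also have "\<dots> = s ^ CARD('k)"
    using assms(1) unfolding unit_cube_eq_cbox by (subst content_cbox_cart) auto
  finally have "measure lebesgue T = s ^ CARD('k)" .
  moreover have "measure lebesgue T \<le> measure lebesgue (unit_cube \<inter> ball x r)"
    using sub by (rule measure_mono_fmeasurable)
      (auto simp: T_def unit_cube_eq_cbox image_affinity_cbox fmeasurable_Int_fmeasurable)
  ultimately show ?thesis by simp
qed

text \<open>The mass of \<open>A\<close> is the volume of its preimage under the graph map, and this
  preimage contains every cube point of the ball.\<close>

lemma measure_graph_measure_ge:
  fixes f :: "real ^ 'k \<Rightarrow> real"
  assumes f: "f \<in> borel_measurable (lebesgue_on unit_cube)"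
    and "A \<in> sets borel" and sub: "\<And>t. t \<in> unit_cube \<inter> ball x r \<Longrightarrow> (t, f t) \<in> A"
  shows "measure lebesgue (unit_cube \<inter> ball x r) \<le> measure (graph_measure f) A"
proof -
  let ?L = "lebesgue_on (unit_cube :: (real ^ 'k) set)"
  have cube: "unit_cube \<in> sets (lebesgue :: (real ^ 'k) measure)"
    by (simp add: unit_cube_eq_cbox)
  interpret finite_measure ?L
    by (rule finite_measureI)
       (simp add: unit_cube_eq_cbox emeasure_restrict_space emeasure_lborel_cbox_eq)
  note m = graph_map_measurable[OF f]
  have "measure lebesgue (unit_cube \<inter> ball x r) = measure ?L (unit_cube \<inter> ball x r)"
    using cube by (intro measure_restrict_space[symmetric]) auto
  also have "\<dots> \<le> measure ?L ((\<lambda>t. (t, f t)) -` A \<inter> space ?L)"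
    using sub m \<open>A \<in> sets borel\<close>
    by (intro finite_measure_mono measurable_sets) (auto simp: space_restrict_space)
  also have "\<dots> = measure (graph_measure f) A"
    unfolding graph_measure_def using m \<open>A \<in> sets borel\<close> by (simp add: measure_distr)
  finally show ?thesis .
qed

section \<open>Volume of the dual box and blow-up for small radii\<close>

lemma measure_ball_times_cball:
  fixes x :: "'a::euclidean_space" and y :: real
  assumes "0 \<le> a" "0 \<le> b"
  shows "ball x a \<times> cball y b \<in> sets lborel"
    and "emeasure lborel (ball x a \<times> cball y b) = ennreal (unit_ball_vol (DIM('a)) * a ^ DIM('a) * (2 * b))"
    and "measure lborel (ball x a \<times> cball y b) = unit_ball_vol (DIM('a)) * a ^ DIM('a) * (2 * b)"
proof -
  show "ball x a \<times> cball y b \<in> sets lborel"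
    by (simp add: borel_Times)
  have "emeasure lborel (ball x a \<times> cball y b)
      = emeasure (lborel \<Otimes>\<^sub>M lborel) (ball x a \<times> cball y b)"
    by (simp add: lborel_prod)
  also have "\<dots> = emeasure lborel (ball x a) * emeasure lborel (cball y b)"
    by (rule lborel.emeasure_pair_measure_Times) auto
  also have "\<dots> = ennreal (unit_ball_vol (DIM('a)) * a ^ DIM('a)) * ennreal (2 * b)"
    using assms by (simp add: emeasure_ball cball_eq_atLeastAtMost)
  also have "\<dots> = ennreal (unit_ball_vol (DIM('a)) * a ^ DIM('a) * (2 * b))"
    using assms by (simp add: ennreal_mult)
  finally show E: "emeasure lborel (ball x a \<times> cball y b)
      = ennreal (unit_ball_vol (DIM('a)) * a ^ DIM('a) * (2 * b))" .
  then show "measure lborel (ball x a \<times> cball y b) = unit_ball_vol (DIM('a)) * a ^ DIM('a) * (2 * b)"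
    using assms by (simp add: measure_def)
qed

text \<open>A negative power of \<open>r\<close> tends to infinity as \<open>r\<close> decreases to
  0. This contradicts a bound uniform in small \<open>r\<close>.\<close>

lemma not_bounded_powr_neg_at_0:
  fixes K B d e :: real
  assumes "0 < K" "0 < d" "e < 0"
  shows "\<exists>r. 0 < r \<and> r < d \<and> B < K * r powr e"
proof -
  have "filterlim (\<lambda>r::real. r powr e) at_top (at_right 0)"
    using assms(3) by real_asymp
  then have "eventually (\<lambda>r. B / K < r powr e) (at_right 0)"
    by (simp add: filterlim_at_top_dense)
  moreover have "eventually (\<lambda>r. 0 < r \<and> r < d) (at_right (0::real))"
    using assms(2) by (auto simp: eventually_at_right)
  ultimately have "eventually (\<lambda>r. 0 < r \<and> r < d \<and> B / K < r powr e) (at_right 0)"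
    by eventually_elim auto
  then have "\<exists>r. 0 < r \<and> r < d \<and> B / K < r powr e"
    by (metis (no_types, lifting) eventually_happens' trivial_limit_at_right_real)
  then show ?thesis
    using assms(1) by (auto simp: field_simps)
qed

section \<open>Testing the extension estimate on the Knapp example\<close>

theorem theorem2p6:
  fixes f :: "real ^ 'k \<Rightarrow> real" and x :: "real ^ 'k"
    and \<alpha> q :: real and p :: ennreal
  assumes "f \<in> borel_measurable (lebesgue_on unit_cube)"
    and "x \<in> unit_cube"
    and "\<alpha> > 0"
    and "locally_holder_at f \<alpha> x"
    and "1 \<le> p"
    and "1 \<le> q"
    and "real CARD('k) * (q - 1) > \<alpha>"
    and "p < ennreal (real CARD('k) * q / (real CARD('k) * (q - 1) - \<alpha>))"
  shows "\<not> extension_estimate (graph_measure f) p (ennreal q)"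
proof
  assume "extension_estimate (graph_measure f) p (ennreal q)"
  then obtain c where c: "0 \<le> c"
    "\<And>g. g \<in> Lp_space p (graph_measure f) \<Longrightarrow>
      Lp_norm (ennreal q) lborel (fourier_meas (graph_measure f) g) \<le> ennreal c * Lp_norm p (graph_measure f) g"
    unfolding extension_estimate_def by blast
  obtain \<delta> C where \<delta>: "0 < \<delta>" "0 < C"
    and holder: "\<And>t. t \<in> unit_cube \<Longrightarrow> norm (x - t) < \<delta> \<Longrightarrow> \<bar>f x - f t\<bar> \<le> C * norm (x - t) powr \<alpha>"
    using assms(4) unfolding locally_holder_at_def by blast
  define k where "k = CARD('k)"
  have q: "0 < q" using assms(6) by simp
  \<comment> \<open>The upper bound on \<open>p\<close> is a real number, which excludes the
    endpoint and allows computing with a real exponent \<open>P\<close>.\<close>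
  have "p < \<infinity>"
    using assms(8) order.strict_trans by (fastforce simp: less_top)
  then obtain P where P: "p = ennreal P" "0 \<le> P"
    by (cases p) auto
  have P1: "1 \<le> P"
    using assms(5) P by (simp add: ennreal_le_iff flip: ennreal_1)
  have PK: "P < real k * q / (real k * (q - 1) - \<alpha>)"
    using assms(8) P by (simp add: ennreal_less_iff k_def)
  \<comment> \<open>The mass, of order at least \<open>r ^ k\<close>, enters with exponent
    \<open>1 - 1 / P\<close>, and the dual volume, of order
    \<open>r powr (- (k + \<alpha>))\<close>, with exponent \<open>1 / q\<close>.\<close>
  define e where "e = real k * (1 - 1 / P) - (real k + \<alpha>) / q"
  \<comment> \<open>Clearing denominators turns this into the bound \<open>PK\<close>; the
    denominator there is positive because \<open>k * (q - 1) > \<alpha>\<close>.\<close>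
  have e: "e < 0"
    using PK P1 q assms(7) by (simp add: e_def k_def field_simps)
  \<comment> \<open>Shrinking the cube by the ratio \<open>r / (2 * D)\<close> moves its points to
    within \<open>r / 2\<close> of \<open>x\<close>.\<close>
  obtain D where D: "0 < D" "\<And>t. t \<in> unit_cube \<Longrightarrow> norm (t - x) \<le> D"
  proof -
    have "bounded ((\<lambda>t. t - x) ` (unit_cube :: (real ^ 'k) set))"
      unfolding unit_cube_eq_cbox by (rule bounded_translation_minus) simp
    then show ?thesis
      using that by (auto simp: bounded_pos)
  qed
  interpret M: finite_measure "graph_measure f"
    using assms(1) by (rule finite_measure_graph_measure)
  have sets_M: "sets (graph_measure f) = sets borel"
    by (simp add: graph_measure_def)
  \<comment> \<open>\<open>K\<close> collects the factors free of \<open>r\<close> in the lower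
    bound for the mass and in the dual volume, each raised to its exponent.\<close>
  define K where "K = (1 / (2 * D)) powr (real k * (1 - 1 / P))
      * (unit_ball_vol k * (1 / 12) ^ k * (1 / (6 * C))) powr (1 / q)"
  have K: "0 < K"
    using D \<delta> unfolding K_def
    by (intro mult_pos_pos powr_gt_zero[THEN iffD2] less_imp_neq[THEN not_sym]) auto
  \<comment> \<open>\<open>r < \<delta>\<close> makes the Hoelder bound available on the ball, and
    \<open>r < D\<close> keeps the shrinking ratio \<open>r / (2 * D)\<close> at most 1.\<close>
  have bound: "K * r powr e \<le> 2 * c" if r: "0 < r" "r < min \<delta> D" for r
  proof -
    define A where "A = ball x r \<times> cball (f x) (C * r powr \<alpha>)"
    \<comment> \<open>The radii are 1/12 of the reciprocals of those of \<open>A\<close>, so the two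
      components of the inner product contribute at most 1/12 each, 1/6 in total.\<close>
    define S where "S = ball (0 :: real ^ 'k) (1 / (12 * r)) \<times> cball (0 :: real) (1 / (12 * C * r powr \<alpha>))"
    define m where "m = measure (graph_measure f) A"
    define V where "V = measure lborel S"
    have A: "A \<in> sets borel"
      unfolding A_def by (intro borel_Times) auto
    have S: "S \<in> sets lborel" "emeasure lborel S < \<infinity>"
      "V = unit_ball_vol k * (1 / (12 * r)) ^ k * (2 * (1 / (12 * C * r powr \<alpha>)))"
      unfolding S_def V_def using r \<delta>
      by (subst measure_ball_times_cball; simp add: k_def)+
    have "(t, f t) \<in> A" if "t \<in> unit_cube \<inter> ball x r" for t
    proof -
      have "\<bar>f x - f t\<bar> \<le> C * norm (x - t) powr \<alpha>"
        using that r by (intro holder) (auto simp: dist_norm)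
      also have "\<dots> \<le> C * r powr \<alpha>"
        using that \<delta> assms(3) by (intro mult_left_mono powr_mono2) (auto simp: dist_norm)
      finally show ?thesis using that by (simp add: A_def dist_real_def)
    qed
    then have "measure lebesgue (unit_cube \<inter> ball x r) \<le> m"
      unfolding m_def by (intro measure_graph_measure_ge assms(1) A)
    moreover have "(r / (2 * D)) ^ k \<le> measure lebesgue (unit_cube \<inter> ball x r)"
      unfolding k_def
    proof (rule unit_cube_ball_measure_ge)
      show "r / (2 * D) * norm (t - x) < r" if "t \<in> unit_cube" for t
      proof -
        have "r / (2 * D) * norm (t - x) \<le> r / (2 * D) * D"
          using D(1) D(2)[OF that] r by (intro mult_left_mono) auto
        also have "\<dots> < r" using D r by simp
        finally show ?thesis .
      qed
    qed (use r D assms in auto)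
    ultimately have m: "(r / (2 * D)) ^ k \<le> m" by simp
    then have m_pos: "0 < m"
      using r D by (smt (verit) zero_less_power divide_pos_pos)
    have phase: "\<bar>\<xi> \<bullet> (y - (x, f x))\<bar> \<le> 1 / 6" if "\<xi> \<in> S" "y \<in> A" for \<xi> y
    proof -
      obtain u v t s where uv: "\<xi> = (u, v)" "y = (t, s)" by (metis surj_pair)
      have "\<bar>u \<bullet> (t - x)\<bar> \<le> norm u * norm (t - x)"
        by (rule Cauchy_Schwarz_ineq2)
      also have "\<dots> \<le> 1 / (12 * r) * r"
        using that r by (intro mult_mono) (auto simp: uv S_def A_def dist_norm norm_minus_commute)
      also have "\<dots> = 1 / 12" using r by simp
      finally have 1: "\<bar>u \<bullet> (t - x)\<bar> \<le> 1 / 12" .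
      have "\<bar>v * (s - f x)\<bar> = \<bar>v\<bar> * \<bar>s - f x\<bar>" by (rule abs_mult)
      also have "\<dots> \<le> 1 / (12 * C * r powr \<alpha>) * (C * r powr \<alpha>)"
        using that r \<delta> by (intro mult_mono) (auto simp: uv S_def A_def dist_real_def)
      also have "\<dots> = 1 / 12" using r \<delta> by simp
      finally have 2: "\<bar>v * (s - f x)\<bar> \<le> 1 / 12" .
      have "\<xi> \<bullet> (y - (x, f x)) = u \<bullet> (t - x) + v * (s - f x)"
        by (simp add: uv)
      with 1 2 show ?thesis by linarith
    qed
    have Lp: "Lp_norm p (graph_measure f) (indicator A) = ennreal (m powr (1 / P))"
      unfolding P m_def using P1 A sets_M
      by (intro Lp_norm_indicator) (auto simp: M.emeasure_eq_measure)
    then have "indicator A \<in> Lp_space p (graph_measure f)"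
      using A sets_M by (simp add: Lp_space_def)
    from c(2)[OF this] have up: "Lp_norm (ennreal q) lborel (fourier_meas (graph_measure f) (indicator A))
        \<le> ennreal (c * m powr (1 / P))"
      using c(1) by (simp add: Lp ennreal_mult)
    have "ennreal (m / 2 * V powr (1 / q))
        \<le> Lp_norm (ennreal q) lborel (fourier_meas (graph_measure f) (indicator A))"
      unfolding V_def m_def using q S A sets_M phase
      by (intro Lp_norm_ge norm_fourier_indicator_ge[where ?y0.0 = "(x, f x)"] M.finite_measure_axioms) auto
    from order.trans[OF this up] have "m / 2 * V powr (1 / q) \<le> c * m powr (1 / P)"
      using c(1) by (simp add: ennreal_le_iff)
    \<comment> \<open>Splitting off \<open>m powr (1 / P)\<close> lets the norm of the indicator
      cancel, since \<open>m\<close> is positive.\<close>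
    moreover have "m = m powr (1 - 1 / P) * m powr (1 / P)"
      using m_pos by (simp flip: powr_add)
    ultimately have "(m powr (1 - 1 / P) * V powr (1 / q)) * m powr (1 / P) \<le> (2 * c) * m powr (1 / P)"
      by (simp add: algebra_simps)
    then have "m powr (1 - 1 / P) * V powr (1 / q) \<le> 2 * c"
      using m_pos by simp
    \<comment> \<open>Since \<open>P\<close> is at least 1 the exponent is nonnegative, so the lower
      bound on \<open>m\<close> survives the power.\<close>
    moreover have "((r / (2 * D)) ^ k) powr (1 - 1 / P) \<le> m powr (1 - 1 / P)"
      using m r D P1 by (intro powr_mono2) auto
    ultimately have *: "((r / (2 * D)) ^ k) powr (1 - 1 / P) * V powr (1 / q) \<le> 2 * c"
      by (smt (verit) mult_right_mono powr_ge_zero)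
    have "(r / (2 * D)) ^ k = (r / (2 * D)) powr k"
      using r D by (simp add: powr_realpow)
    then have "((r / (2 * D)) ^ k) powr (1 - 1 / P) = (r * (1 / (2 * D))) powr (real k * (1 - 1 / P))"
      by (simp add: powr_powr)
    also have "\<dots> = (1 / (2 * D)) powr (real k * (1 - 1 / P)) * r powr (real k * (1 - 1 / P))"
      using r D by (subst powr_mult) auto
    finally have 1: "((r / (2 * D)) ^ k) powr (1 - 1 / P)
        = (1 / (2 * D)) powr (real k * (1 - 1 / P)) * r powr (real k * (1 - 1 / P))" .
    have "V = (unit_ball_vol k * (1 / 12) ^ k * (1 / (6 * C))) * r powr (- (real k + \<alpha>))"
    proof -
      have "r powr (- (real k + \<alpha>)) = 1 / (r ^ k * r powr \<alpha>)"
        using r by (simp only: powr_minus_divide powr_add powr_realpow)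
      then show ?thesis
        unfolding S(3) by (simp add: power_divide power_mult_distrib)
    qed
    then have "V powr (1 / q) = (unit_ball_vol k * (1 / 12) ^ k * (1 / (6 * C))) powr (1 / q)
        * (r powr (- (real k + \<alpha>))) powr (1 / q)"
      using \<delta> by (simp only:) (intro powr_mult; simp)
    also have "(r powr (- (real k + \<alpha>))) powr (1 / q) = r powr (- (real k + \<alpha>) / q)"
      by (simp add: powr_powr)
    finally have 2: "V powr (1 / q) = (unit_ball_vol k * (1 / 12) ^ k * (1 / (6 * C))) powr (1 / q)
        * r powr (- (real k + \<alpha>) / q)" .
    have "r powr e = r powr (real k * (1 - 1 / P)) * r powr (- (real k + \<alpha>) / q)"
      unfolding e_def by (simp only: powr_add[symmetric] minus_divide_left[symmetric] diff_conv_add_uminus)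
    then have "K * r powr e = ((r / (2 * D)) ^ k) powr (1 - 1 / P) * V powr (1 / q)"
      unfolding 1 2 K_def by (simp only: ac_simps)
    with * show ?thesis by simp
  qed
  obtain r where "0 < r" "r < min \<delta> D" "2 * c < K * r powr e"
    using not_bounded_powr_neg_at_0[of K "min \<delta> D" e "2 * c"] K e \<delta> D by auto
  with bound show False by force
qed

end
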